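(* Let $(W,\mathcal{M})$ be a finite social decision frame. If $(W,\mathcal{M})$ is measurable, then it is coherent.
   Context: A finite social decision frame is a pair $(W,\mathcal{M})$ where $W$ is a nonempty finite set and $\mathcal{M}$ is a family of subsets of $W$. Put $A^c=W\setminus A$ and $\mathcal{H}=\{A\subseteq W: A\notin\mathcal{M}\text{ and }A^c\notin\mathcal{M}\}$. The frame is measurable if there is a finitely additive set function $\mu$ on all subsets of $W$, with values in the natural numbers, $\mu(\varnothing)=0$ and $\mu(\{w\})>0$ for every $w\in W$, such that for every $A\subseteq W$: $A\in\mathcal{M}$ if and only if $\mu(A)>\frac12\mu(W)$. The frame is coherent if for every positive integer $n$ and every sequence $A_1,\dots,A_n$ of subsets of $W$ (repetitions allowed): if (c1) $A_i\in\mathcal{M}\cup\mathcal{H}$ for all $i$, and (c2) every $w\in W$ satisfies $|\{i\le n: w\in A_i\}|\le n/2$; then (c3) $A_i\in\mathcal{H}$ for all $i$, and (c4) every $w\in W$ satisfies $|\{i\le n: w\in A_i\}|= n/2$. *)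

theory Defs
  imports "HOL-Analysis.Measure_Space"
begin

definition social_decision_frame :: "'a set \<Rightarrow> 'a set set \<Rightarrow> bool" where
  "social_decision_frame W M \<longleftrightarrow> finite W \<and> W \<noteq> {} \<and> M \<subseteq> Pow W"

definition half_sets :: "'a set \<Rightarrow> 'a set set \<Rightarrow> 'a set set" where
  "half_sets W M = {A. A \<subseteq> W \<and> A \<notin> M \<and> W - A \<notin> M}"

definition measurable_frame :: "'a set \<Rightarrow> 'a set set \<Rightarrow> bool" where
  "measurable_frame W M \<longleftrightarrow>
     (\<exists>\<mu> :: 'a set \<Rightarrow> nat.
        \<mu> {} = 0 \<and>
        Measure_Space.additive (Pow W) \<mu> \<and>
        (\<forall>w\<in>W. \<mu> {w} > 0) \<and>
        (\<forall>A. A \<subseteq> W \<longrightarrow> (A \<in> M \<longleftrightarrow> real (\<mu> A) > 1 / 2 * real (\<mu> W))))"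

definition coherent_frame :: "'a set \<Rightarrow> 'a set set \<Rightarrow> bool" where
  "coherent_frame W M \<longleftrightarrow>
     (\<forall>n :: nat. n > 0 \<longrightarrow>
        (\<forall>A :: nat \<Rightarrow> 'a set.
           (\<forall>i\<in>{1..n}. A i \<subseteq> W) \<longrightarrow>
           (\<forall>i\<in>{1..n}. A i \<in> M \<union> half_sets W M) \<longrightarrow>
           (\<forall>w\<in>W. real (card {i \<in> {1..n}. w \<in> A i}) \<le> real n / 2) \<longrightarrow>
           (\<forall>i\<in>{1..n}. A i \<in> half_sets W M) \<and>
           (\<forall>w\<in>W. real (card {i \<in> {1..n}. w \<in> A i}) = real n / 2)))"

end

theory Submission
  imports Defs
begin

text \<open>
  Let \<open>c w\<close> be the number of indices \<open>i \<le> n\<close> with \<open>w \<in> A i\<close>. Double counting gives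
  \<open>(\<Sum>i. 2 \<mu> (A i)) = (\<Sum>w. 2 c w \<mu> {w})\<close>. By (c1) the left side is at least \<open>n \<mu> W\<close>, and by (c2)
  the right side is at most \<open>n \<mu> W\<close>. So both estimates are equalities term by term, and
  positivity of \<open>\<mu> {w}\<close> then gives \<open>2 c w = n\<close>.
\<close>

text \<open>Induction on the finite set \<open>A\<close>, splitting off one point at a time: the
  values on singletons determine \<open>\<mu>\<close>.\<close>

lemma additive_eq_sum_singletons:
  fixes \<mu> :: "'a set \<Rightarrow> 'b::comm_monoid_add"
  assumes "finite W" "\<mu> {} = 0" "additive (Pow W) \<mu>" "A \<subseteq> W"
  shows "\<mu> A = (\<Sum>w\<in>A. \<mu> {w})"
proof -
  have "finite A" using assms finite_subset by blast
  then show ?thesis using \<open>A \<subseteq> W\<close>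
  proof (induction A rule: finite_induct)
    case empty
    then show ?case using assms by simp
  next
    case (insert x A)
    have "\<mu> ({x} \<union> A) = \<mu> {x} + \<mu> A"
      using insert by (intro additiveD[OF assms(3)]) auto
    then show ?case using insert by simp
  qed
qed

text \<open>Double counting of the pairs \<open>(i, w)\<close> with \<open>w \<in> A i\<close>, each
  weighted by \<open>f w\<close>; swapping the sums leaves an inner sum constant in
  \<open>i\<close>.\<close>

lemma sum_sum_members_eq_sum_card:
  fixes f :: "'a \<Rightarrow> nat"
  assumes "finite W" "finite I" "\<And>i. i \<in> I \<Longrightarrow> A i \<subseteq> W"
  shows "(\<Sum>i\<in>I. \<Sum>w\<in>A i. f w) = (\<Sum>w\<in>W. card {i \<in> I. w \<in> A i} * f w)"
proof -
  have "(\<Sum>i\<in>I. \<Sum>w\<in>A i. f w) = (\<Sum>i\<in>I. \<Sum>w\<in>{w\<in>W. w \<in> A i}. f w)"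
    using assms(3) by (intro sum.cong) auto
  also have "\<dots> = (\<Sum>w\<in>W. \<Sum>i\<in>{i\<in>I. w \<in> A i}. f w)"
    by (rule sum.swap_restrict) (use assms in auto)
  finally show ?thesis by simp
qed

theorem lemma3p3:
  fixes W :: "'a set" and M :: "'a set set"
  assumes "social_decision_frame W M"
    and "measurable_frame W M"
  shows "coherent_frame W M"
proof -
  have fin: "finite W" using assms(1) by (simp add: social_decision_frame_def)
  obtain \<mu> :: "'a set \<Rightarrow> nat" where empty: "\<mu> {} = 0" and add: "additive (Pow W) \<mu>"
    and pos: "\<And>w. w \<in> W \<Longrightarrow> \<mu> {w} > 0"
    and "\<And>A. A \<subseteq> W \<Longrightarrow> A \<in> M \<longleftrightarrow> real (\<mu> A) > 1 / 2 * real (\<mu> W)"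
    using assms(2) unfolding measurable_frame_def by blast
  \<comment> \<open>Clearing the factor 1/2 keeps all later estimates in the natural
    numbers.\<close>
  then have M_iff: "A \<in> M \<longleftrightarrow> \<mu> W < 2 * \<mu> A" if "A \<subseteq> W" for A
    using that by force
  have compl: "\<mu> A + \<mu> (W - A) = \<mu> W" if "A \<subseteq> W" for A
    using additiveD[OF add, of A "W - A"] that by (auto simp: Un_absorb1)
  \<comment> \<open>Neither \<open>A\<close> nor \<open>W - A\<close> exceeds half of
    \<open>\<mu> W\<close>, yet by \<open>compl\<close> they add up to \<open>\<mu> W\<close>, so
    each is exactly half.\<close>
  have H_iff: "A \<in> half_sets W M \<longleftrightarrow> 2 * \<mu> A = \<mu> W" if "A \<subseteq> W" for A
    using that compl[OF that] M_iff[OF that] M_iff[of "W - A"] by (auto simp: half_sets_def)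
  show ?thesis
    unfolding coherent_frame_def
  proof (intro allI impI)
    fix n :: nat and A :: "nat \<Rightarrow> 'a set"
    define c where "c w = card {i \<in> {1..n}. w \<in> A i}" for w
    assume sub: "\<forall>i\<in>{1..n}. A i \<subseteq> W"
      and c1: "\<forall>i\<in>{1..n}. A i \<in> M \<union> half_sets W M"
      and "\<forall>w\<in>W. real (card {i \<in> {1..n}. w \<in> A i}) \<le> real n / 2"
    then have c2: "2 * c w \<le> n" if "w \<in> W" for w
      using that unfolding c_def by fastforce
    have lower: "\<mu> W \<le> 2 * \<mu> (A i)" if "i \<in> {1..n}" for i
      using that sub c1 M_iff[of "A i"] H_iff[of "A i"] by auto
    have upper: "2 * c w * \<mu> {w} \<le> n * \<mu> {w}" if "w \<in> W" for w
      using c2[OF that] by simp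
    have "(\<Sum>i\<in>{1..n}. \<mu> (A i)) = (\<Sum>i\<in>{1..n}. \<Sum>w\<in>A i. \<mu> {w})"
      using sub by (intro sum.cong refl additive_eq_sum_singletons[OF fin empty add]) auto
    also have "\<dots> = (\<Sum>w\<in>W. c w * \<mu> {w})"
      unfolding c_def using fin sub by (intro sum_sum_members_eq_sum_card) auto
    finally have count: "(\<Sum>i\<in>{1..n}. 2 * \<mu> (A i)) = (\<Sum>w\<in>W. 2 * c w * \<mu> {w})"
      by (simp add: sum_distrib_left[symmetric] mult.assoc)
    \<comment> \<open>Both sides are \<open>n * \<mu> W\<close>, so the lower and upper estimates
      have the same bound and the chain through \<open>count\<close> closes up.\<close>
    have total: "(\<Sum>i\<in>{1..n}. \<mu> W) = (\<Sum>w\<in>W. n * \<mu> {w})"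
      using additive_eq_sum_singletons[OF fin empty add order.refl]
      by (simp add: sum_distrib_left)
    have "(\<Sum>i\<in>{1..n}. \<mu> W) \<le> (\<Sum>i\<in>{1..n}. 2 * \<mu> (A i))"
      using lower by (rule sum_mono)
    moreover have "(\<Sum>w\<in>W. 2 * c w * \<mu> {w}) \<le> (\<Sum>w\<in>W. n * \<mu> {w})"
      using upper by (rule sum_mono)
    ultimately have eq1: "(\<Sum>i\<in>{1..n}. \<mu> W) = (\<Sum>i\<in>{1..n}. 2 * \<mu> (A i))"
      and eq2: "(\<Sum>w\<in>W. 2 * c w * \<mu> {w}) = (\<Sum>w\<in>W. n * \<mu> {w})"
      using count total by linarith+
    \<comment> \<open>Equal finite sums with termwise \<open>\<le>\<close> agree term by term; by
      \<open>H_iff\<close> the equality at \<open>i\<close> is membership in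
      \<open>half_sets W M\<close>.\<close>
    have "A i \<in> half_sets W M" if "i \<in> {1..n}" for i
      using sum_mono_inv[OF eq1 lower that] sub that H_iff by simp
    moreover have "real (c w) = real n / 2" if "w \<in> W" for w
    proof -
      \<comment> \<open>Termwise equality again, now cancelling the factor \<open>\<mu> {w}\<close>,
        which is nonzero by \<open>pos\<close>.\<close>
      have "2 * c w = n"
        using sum_mono_inv[OF eq2 upper that fin] pos[OF that] by simp
      then show ?thesis by linarith
    qed
    ultimately show "(\<forall>i\<in>{1..n}. A i \<in> half_sets W M) \<and>
        (\<forall>w\<in>W. real (card {i \<in> {1..n}. w \<in> A i}) = real n / 2)"
      unfolding c_def by blast
  qed
qed

end
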